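(* Let $\mathcal A=(Q,\Sigma,\delta,q_0,F)$ be a DFA such that $L(\mathcal A)$ is commutative. If $\Gamma\subseteq\Sigma$, then $\pi_\Gamma(L(\mathcal A))$ is recognizable by a DFA with at most $|Q|$ states.
   Context: A (partial) deterministic finite automaton (DFA) is a quintuple $\mathcal A=(Q,\Sigma,\delta,q_0,F)$ with finite state set $Q$, finite alphabet $\Sigma$, partial transition function $\delta:Q\times\Sigma\to Q$ (extended to words in the usual way), start state $q_0\in Q$ and final states $F\subseteq Q$. It recognizes $L(\mathcal A)=\{u\in\Sigma^*\mid \delta(q_0,u)\text{ is defined and in }F\}$. A language $L\subseteq\Sigma^*$ is commutative if it is closed under permuting the letters of words, i.e. $uabv\in L \Leftrightarrow ubav\in L$ for all $u,v\in\Sigma^*$, $a,b\in\Sigma$. For $\Gamma\subseteq\Sigma$, the projection $\pi_\Gamma:\Sigma^*\to\Gamma^*$ is the monoid homomorphism with $\pi_\Gamma(x)=x$ for $x\in\Gamma$ and $\pi_\Gamma(x)=\varepsilon$ for $x\in\Sigma\setminus\Gamma$. The recognizing DFA in the conclusion is over the alphabet $\Gamma$ and may be partial. *)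

theory Defs
  imports Main
begin

record ('q, 'a) dfa =
  states :: "'q set"
  alphabet :: "'a set"
  trans :: "'q \<times> 'a \<rightharpoonup> 'q"
  start :: 'q
  final :: "'q set"

(* dom_trans and ran_trans make trans a partial function from
   states * alphabet to states; completeness is not required. *)
locale wf_dfa =
  fixes A :: "('q, 'a) dfa"
  assumes finite_states: "finite (states A)"
    and finite_alphabet: "finite (alphabet A)"
    and dom_trans: "dom (trans A) \<subseteq> states A \<times> alphabet A"
    and ran_trans: "ran (trans A) \<subseteq> states A"
    and start_in_states: "start A \<in> states A"
    and final_subset: "final A \<subseteq> states A"

fun run :: "('q, 'a) dfa \<Rightarrow> 'q \<Rightarrow> 'a list \<Rightarrow> 'q option" where
  "run A q [] = Some q"
| "run A q (a # w) = (case trans A (q, a) of None \<Rightarrow> None | Some p \<Rightarrow> run A p w)"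

definition lang :: "('q, 'a) dfa \<Rightarrow> 'a list set" where
  "lang A = {w \<in> lists (alphabet A). \<exists>q \<in> final A. run A (start A) w = Some q}"

definition commutative_lang :: "'a set \<Rightarrow> 'a list set \<Rightarrow> bool" where
  "commutative_lang \<Sigma> L \<longleftrightarrow> L \<subseteq> lists \<Sigma> \<and>
    (\<forall>u \<in> lists \<Sigma>. \<forall>v \<in> lists \<Sigma>. \<forall>a \<in> \<Sigma>. \<forall>b \<in> \<Sigma>.
      u @ [a, b] @ v \<in> L \<longleftrightarrow> u @ [b, a] @ v \<in> L)"

definition proj :: "'a set \<Rightarrow> 'a list \<Rightarrow> 'a list" where
  "proj \<Gamma> w = filter (\<lambda>x. x \<in> \<Gamma>) w"

lemma proj_hom:
  "proj \<Gamma> [] = []"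
  "proj \<Gamma> (u @ v) = proj \<Gamma> u @ proj \<Gamma> v"
  "proj \<Gamma> [x] = (if x \<in> \<Gamma> then [x] else [])"
  by (simp_all add: proj_def)

(* Every finite state set embeds into nat, so restricting the state type of the
   recognizing automaton to nat loses no generality. *)
definition recognizable_with :: "'a set \<Rightarrow> 'a list set \<Rightarrow> nat \<Rightarrow> bool" where
  "recognizable_with \<Gamma> L n \<longleftrightarrow>
    (\<exists>B :: (nat, 'a) dfa. wf_dfa B \<and> alphabet B = \<Gamma> \<and> lang B = L \<and> card (states B) \<le> n)"

end

theory Submission
  imports Defs
begin

text \<open>By commutativity, a word of the language can be sorted so that its letters from \<open>\<Gamma>\<close> come
  first. Hence a word over \<open>\<Gamma>\<close> lies in the projection iff it leads to a state from which a final
  state is reachable by letters outside \<open>\<Gamma>\<close>: it suffices to enlarge the set of final states and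
  to restrict the transitions to \<open>\<Gamma>\<close>.\<close>

lemma run_append:
  "run A q (u @ v) = (case run A q u of None \<Rightarrow> None | Some p \<Rightarrow> run A p v)"
  by (induction u arbitrary: q) (auto split: option.splits)

lemma (in wf_dfa) run_in_states:
  assumes "q \<in> states A" "run A q u = Some p"
  shows "p \<in> states A"
  using assms
proof (induction u arbitrary: q)
  case (Cons a u)
  then obtain r where "trans A (q, a) = Some r" "run A r u = Some p"
    by (auto split: option.splits)
  then show ?case
    using Cons.IH ran_trans by (auto intro: ranI)
qed simp

text \<open>Adjacent swaps carry \<open>a\<close> across \<open>u\<close> one letter at a time. The
  prefix \<open>x\<close> is generalized in the induction because each letter that \<open>a\<close>
  has passed joins it.\<close>

lemma commutative_lang_move_letter:
  assumes "commutative_lang \<Sigma> L"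
    and "x \<in> lists \<Sigma>" "a \<in> \<Sigma>" "u \<in> lists \<Sigma>" "v \<in> lists \<Sigma>"
  shows "x @ a # u @ v \<in> L \<longleftrightarrow> x @ u @ a # v \<in> L"
  using assms(2,4)
proof (induction u arbitrary: x)
  case (Cons b u)
  have "x @ [a, b] @ (u @ v) \<in> L \<longleftrightarrow> x @ [b, a] @ (u @ v) \<in> L"
    using assms Cons.prems unfolding commutative_lang_def by (metis append_in_lists_conv Cons_in_lists_iff)
  with Cons.IH[of "x @ [b]"] Cons.prems show ?case
    by simp
qed simp

text \<open>A stable partition by insertion: the tail is partitioned behind the prefix
  \<open>x @ [a]\<close>, so \<open>a\<close> stands in front of both blocks. If \<open>P a\<close>
  holds, that is already its place.\<close>

lemma commutative_lang_partition:
  assumes "commutative_lang \<Sigma> L" "x \<in> lists \<Sigma>" "w \<in> lists \<Sigma>"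
  shows "x @ w \<in> L \<longleftrightarrow> x @ filter P w @ filter (\<lambda>a. \<not> P a) w \<in> L"
  using assms(2,3)
proof (induction w arbitrary: x)
  case (Cons a w)
  \<comment> \<open>This is used when \<open>P a\<close> fails: \<open>a\<close> then has to cross
    the block of letters satisfying \<open>P\<close>.\<close>
  have "x @ a # filter P w @ filter (\<lambda>a. \<not> P a) w \<in> L
      \<longleftrightarrow> x @ filter P w @ a # filter (\<lambda>a. \<not> P a) w \<in> L"
    using Cons.prems by (intro commutative_lang_move_letter[OF assms(1)]) auto
  with Cons.IH[of "x @ [a]"] Cons.prems show ?case
    by simp
qed simp

lemma proj_commutative_lang:
  assumes "commutative_lang \<Sigma> L" "\<Gamma> \<subseteq> \<Sigma>"
  shows "proj \<Gamma> ` L = {u \<in> lists \<Gamma>. \<exists>v \<in> lists (\<Sigma> - \<Gamma>). u @ v \<in> L}"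
proof (intro equalityI subsetI)
  fix u
  assume "u \<in> proj \<Gamma> ` L"
  then obtain w where w: "w \<in> L" and u: "u = filter (\<lambda>x. x \<in> \<Gamma>) w"
    by (auto simp: proj_def)
  have "w \<in> lists \<Sigma>"
    using assms(1) w by (auto simp: commutative_lang_def)
  moreover from this have "u @ filter (\<lambda>x. x \<notin> \<Gamma>) w \<in> L"
    using commutative_lang_partition[OF assms(1), of "[]" w "\<lambda>x. x \<in> \<Gamma>"] w u by simp
  ultimately show "u \<in> {u \<in> lists \<Gamma>. \<exists>v \<in> lists (\<Sigma> - \<Gamma>). u @ v \<in> L}"
    using u by (auto intro!: bexI[of _ "filter (\<lambda>x. x \<notin> \<Gamma>) w"])
next
  fix u
  assume "u \<in> {u \<in> lists \<Gamma>. \<exists>v \<in> lists (\<Sigma> - \<Gamma>). u @ v \<in> L}"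
  then obtain v where "u \<in> lists \<Gamma>" "v \<in> lists (\<Sigma> - \<Gamma>)" "u @ v \<in> L"
    by auto
  moreover from this have "proj \<Gamma> (u @ v) = u"
    by (auto simp: proj_def filter_empty_conv)
  ultimately show "u \<in> proj \<Gamma> ` L"
    by (metis imageI)
qed

definition proj_dfa :: "'a set \<Rightarrow> ('q \<Rightarrow> 'r) \<Rightarrow> ('q, 'a) dfa \<Rightarrow> ('r, 'a) dfa" where
  "proj_dfa \<Gamma> f A =
    \<lparr>states = f ` states A,
     alphabet = \<Gamma>,
     trans = (\<lambda>(n, a). if n \<in> f ` states A \<and> a \<in> \<Gamma>
       then map_option f (trans A (inv_into (states A) f n, a)) else None),
     start = f (start A),
     final = f ` {q \<in> states A. \<exists>v \<in> lists (alphabet A - \<Gamma>). \<exists>p \<in> final A. run A q v = Some p}\<rparr>"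

context wf_dfa
begin

lemma wf_proj_dfa:
  assumes "\<Gamma> \<subseteq> alphabet A"
  shows "wf_dfa (proj_dfa \<Gamma> f A)"
proof
  show "finite (alphabet (proj_dfa \<Gamma> f A))"
    using assms finite_alphabet by (auto simp: proj_dfa_def intro: finite_subset)
  show "ran (trans (proj_dfa \<Gamma> f A)) \<subseteq> states (proj_dfa \<Gamma> f A)"
    using ran_trans by (auto simp: proj_dfa_def ran_def split: if_splits)
qed (use finite_states start_in_states in \<open>auto simp: proj_dfa_def split: if_splits\<close>)

text \<open>Injectivity makes \<open>inv_into\<close> undo \<open>f\<close> on states, so on words
  over \<Gamma> the two automata move in lockstep, and one run is undefined exactly when the other
  is.\<close>

lemma run_proj_dfa:
  assumes "inj_on f (states A)" "q \<in> states A" "u \<in> lists \<Gamma>"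
  shows "run (proj_dfa \<Gamma> f A) (f q) u = map_option f (run A q u)"
  using assms(2,3)
proof (induction u arbitrary: q)
  case (Cons a u)
  have "trans (proj_dfa \<Gamma> f A) (f q, a) = map_option f (trans A (q, a))"
    using assms(1) Cons.prems by (simp add: proj_dfa_def)
  moreover have "r \<in> states A" if "trans A (q, a) = Some r" for r
    using that ran_trans by (auto intro: ranI)
  ultimately show ?case
    using Cons by (auto split: option.splits)
qed simp

lemma lang_proj_dfa:
  assumes "inj_on f (states A)" "\<Gamma> \<subseteq> alphabet A"
  shows "lang (proj_dfa \<Gamma> f A) =
    {u \<in> lists \<Gamma>. \<exists>v \<in> lists (alphabet A - \<Gamma>). u @ v \<in> lang A}"
proof -
  let ?R = "{q \<in> states A. \<exists>v \<in> lists (alphabet A - \<Gamma>). \<exists>p \<in> final A. run A q v = Some p}"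
  have "(\<exists>n \<in> f ` ?R. run (proj_dfa \<Gamma> f A) (f (start A)) u = Some n)
      \<longleftrightarrow> (\<exists>v \<in> lists (alphabet A - \<Gamma>). u @ v \<in> lang A)" (is "?lhs \<longleftrightarrow> ?rhs")
    if u: "u \<in> lists \<Gamma>" for u
  proof -
    have "?lhs \<longleftrightarrow> (\<exists>q \<in> ?R. run A (start A) u = Some q)"
    proof (cases "run A (start A) u")
      case None
      then show ?thesis
        using run_proj_dfa[OF assms(1) start_in_states u] by simp
    next
      case (Some q)
      then have "q \<in> states A"
        using run_in_states[OF start_in_states] by simp
      \<comment> \<open>Renaming cannot make a state final by merging it with another, as
        \<open>q\<close> and \<open>?R\<close> both lie where \<open>f\<close> is injective.\<close>
      then have "f q \<in> f ` ?R \<longleftrightarrow> q \<in> ?R"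
        using assms(1) by (intro inj_on_image_mem_iff) auto
      then show ?thesis
        using run_proj_dfa[OF assms(1) start_in_states u] Some by simp
    qed
    \<comment> \<open>The run on \<open>u @ v\<close> splits at the state reached after
      \<open>u\<close>, which lies in \<open>states A\<close> as \<open>?R\<close> demands.\<close>
    also have "\<dots> \<longleftrightarrow> (\<exists>v \<in> lists (alphabet A - \<Gamma>). \<exists>p \<in> final A. run A (start A) (u @ v) = Some p)"
      using run_in_states[OF start_in_states, of u]
      by (cases "run A (start A) u") (simp_all add: run_append)
    \<comment> \<open>Since \<Gamma> is part of the alphabet, \<open>u @ v\<close> is a word over
      \<open>alphabet A\<close>, as \<open>lang\<close> requires.\<close>
    also have "\<dots> \<longleftrightarrow> ?rhs"
      using u assms(2) by (fastforce simp: lang_def)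
    finally show ?thesis .
  qed
  moreover have "alphabet (proj_dfa \<Gamma> f A) = \<Gamma>" "start (proj_dfa \<Gamma> f A) = f (start A)"
      "final (proj_dfa \<Gamma> f A) = f ` ?R"
    by (simp_all add: proj_dfa_def)
  \<comment> \<open>The congruence rule supplies \<open>u \<in> lists \<Gamma>\<close> while the
    acceptance condition is rewritten.\<close>
  ultimately show ?thesis
    unfolding lang_def[of "proj_dfa \<Gamma> f A"] by (simp only: cong: conj_cong)
qed

end

theorem theorem13:
  fixes A :: "('q, 'a) dfa" and \<Gamma> :: "'a set"
  assumes "wf_dfa A"
    and "commutative_lang (alphabet A) (lang A)"
    and "\<Gamma> \<subseteq> alphabet A"
  shows "recognizable_with \<Gamma> (proj \<Gamma> ` lang A) (card (states A))"
proof -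
  interpret wf_dfa A by fact
  obtain f :: "'q \<Rightarrow> nat" where f: "inj_on f (states A)"
    using finite_imp_inj_to_nat_seg[OF finite_states] by blast
  have "lang (proj_dfa \<Gamma> f A) = proj \<Gamma> ` lang A"
    using lang_proj_dfa[OF f assms(3)] proj_commutative_lang[OF assms(2,3)] by simp
  moreover have "alphabet (proj_dfa \<Gamma> f A) = \<Gamma>" "card (states (proj_dfa \<Gamma> f A)) \<le> card (states A)"
    using finite_states by (simp_all add: proj_dfa_def card_image_le)
  ultimately show ?thesis
    using wf_proj_dfa[OF assms(3)] unfolding recognizable_with_def by blast
qed

end
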